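(* Let $I,J,K$ be pairwise disjoint countable index sets, let $r_i\in\mathbb{Z}_+$ for all $i\in I\cup J\cup K$ and $s_i\in\mathbb{Z}_{\geq0}$ for all $i\in I\cup J$, and put $\mathcal{U}=\{(r_i,s_i)\mid i\in I\}$, $\mathcal{V}=\{(r_i,s_i)\mid i\in J\}$, $\mathcal{W}=\{(r_i,-1)\mid i\in K\}$. Let $f:\mathbb{Z}_+\to\mathbb{C}$, $F(x)=1+\sum_{\ell\geq1}f(\ell)x^\ell$, $V(x,y)=\sum_{i\in J}x^{r_i}y^{s_i}$, and let $p_n$ be as in the context. (A1) If $\mathcal{U}=\{(1,s)\}$ for some $s\in\mathbb{Z}_{\geq0}$, $r_i=1$ for all $i\in J$, and $\mathcal{W}=\{(1,-1)\}$, then for all $n\geq0$ \[p_n=\sum_{i=0}^{\lfloor\frac{n}{s+1}\rfloor}\frac1{n-i+1}\left([x^i]F(x)^{n-i+1}\right)\left([x^{n-(s+1)i}]\left(1+xV(1,x)\right)^{n-i+1}\right).\] (A2) If $\mathcal{U}=\{(r_1,s_1)\}$, $\mathcal{V}=\{(r_2,s_2)\}$ and $\mathcal{W}=\{(w,-1)\}$ (with $r_1,r_2,w\in\mathbb{Z}_+$, $s_1,s_2\in\mathbb{Z}_{\geq0}$), then for all $n\geq0$ \[p_n=\sum_{\substack{(ws_1+r_1)i+(ws_2+r_2)j=n\\i,j\geq0}}\frac{1}{s_1i+(s_2+1)j+1}\left([x^i]F(x)^{s_1i+(s_2+1)j+1}\right)\binom{s_1i+(s_2+1)j+1}{j}.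\]
   Context: For $n\in\mathbb{Z}_{\geq0}$, $\mathcal{P}_n$ denotes the set of lattice paths from $(0,0)$ to $(n,0)$ that never go below the $x$-axis and each of whose steps lies in $\mathcal{U}\cup\mathcal{V}\cup\mathcal{W}$. For $P\in\mathcal{P}_n$, $\mathbf{u}(P)$ is the vector recording, in order, the lengths of the maximal blocks of consecutive steps of $P$ that belong to $\mathcal{U}$, and $p_n=\sum_{P\in\mathcal{P}_n}\prod_{i=1}^{|\mathbf{u}(P)|}f(\mathbf{u}(P)_i)$ (empty product $=1$). $[x^m]G(x)$ denotes the coefficient of $x^m$ in the power series $G$.
   Formalization: Assumes in addition that U and V are disjoint as sets of steps and, in (A1), that distinct i in J give distinct (r_i,s_i); otherwise the formulas overcount: for U=V={(1,0)}, W={(1,-1)}, p_1=f(1) but the formula gives f(1)+1. *)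

theory Defs
  imports
    "HOL-Analysis.Infinite_Sum"
    "HOL-Computational_Algebra.Formal_Power_Series"
    "HOL-Library.Product_Plus"
    "HOL-Library.Countable_Set"
begin

text \<open>
  A lattice path starting at the origin is given by the list of its steps; its vertices are the
  partial sums. Since steps are straight segments, a path stays weakly above the \<open>x\<close>-axis
  iff all its vertices do.
\<close>

definition lattice_paths :: "(int \<times> int) set \<Rightarrow> nat \<Rightarrow> (int \<times> int) list set" where
  "lattice_paths S n =
     {P. set P \<subseteq> S \<and> sum_list P = (int n, 0) \<and>
         (\<forall>k\<le>length P. snd (sum_list (take k P)) \<ge> 0)}"

function block_lengths :: "'a set \<Rightarrow> 'a list \<Rightarrow> nat list" where
  "block_lengths A [] = []"
| "block_lengths A (x # xs) =
     (if x \<in> A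
      then Suc (length (takeWhile (\<lambda>y. y \<in> A) xs)) # block_lengths A (dropWhile (\<lambda>y. y \<in> A) xs)
      else block_lengths A xs)"
  by pat_completeness auto
termination
  by (relation "measure (\<lambda>(A, xs). length xs)") (auto simp: le_imp_less_Suc length_dropWhile_le)

definition weighted_count ::
  "(int \<times> int) set \<Rightarrow> (int \<times> int) set \<Rightarrow> (int \<times> int) set \<Rightarrow> (nat \<Rightarrow> complex) \<Rightarrow> nat \<Rightarrow> complex" where
  "weighted_count U V W f n =
     (\<Sum>P\<in>lattice_paths (U \<union> V \<union> W) n. prod_list (map f (block_lengths U P)))"

definition F_series :: "(nat \<Rightarrow> complex) \<Rightarrow> complex fps" where
  "F_series f = Abs_fps (\<lambda>l. if l = 0 then 1 else f l)"

text \<open>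
  The possibly infinite sum is taken in the usual (coefficientwise) topology on power series;
  it converges as soon as every coefficient receives finitely many contributions.
\<close>

definition V_series ::
  "'i set \<Rightarrow> ('i \<Rightarrow> nat) \<Rightarrow> ('i \<Rightarrow> nat) \<Rightarrow> complex fps \<Rightarrow> complex fps \<Rightarrow> complex fps" where
  "V_series J r s x y = (\<Sum>\<^sub>\<infinity>i\<in>J. x ^ r i * y ^ s i)"

end

theory Submission
  imports Defs
begin

text \<open>
  A path followed by one extra down step is cut after every step outside \<open>U\<close>, giving a list of
  \<open>m\<close> pieces, each a block of \<open>U\<close>-steps (possibly empty) closed by a single other step. The path
  stays above the axis iff all proper prefixes of the list have nonnegative total rise, while the
  whole list has rise \<open>-1\<close>. By the cycle lemma exactly one of the \<open>m\<close> rotations of any list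
  of rise \<open>-1\<close> has this property, whence the factor \<open>1/m\<close>. For unrestricted lists the
  block lengths and the closing steps are independent: the former contribute \<open>[x^i] F(x)^m\<close>,
  the latter the coefficient of a power of \<open>1 + x V(1,x)\<close> in the first case and a binomial
  coefficient in the second.
\<close>


section \<open>The cycle lemma for lists of total rise \<open>-1\<close>\<close>

definition prefix_nonneg :: "('a \<Rightarrow> int) \<Rightarrow> 'a list \<Rightarrow> bool" where
  "prefix_nonneg h l \<longleftrightarrow> (\<forall>k<length l. 0 \<le> sum_list (map h (take k l)))"

text \<open>A cut at \<open>0 < k < length l\<close> splits the list into a proper prefix of
  \<open>l\<close> and a proper prefix of its rotation. If both lists were good, both parts would
  have nonnegative sum, against the total \<open>-1\<close>.\<close>

lemma prefix_nonneg_unique_rotation: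
  assumes "sum_list (map h l) = -1" "prefix_nonneg h l" "prefix_nonneg h (rotate k l)" "k < length l"
  shows "k = 0"
proof (rule ccontr)
  assume "k \<noteq> 0"
  have rot: "rotate k l = drop k l @ take k l"
    using assms(4) by (simp add: rotate_drop_take)
  have "0 \<le> sum_list (map h (take k l))"
    using assms(2,4) by (simp add: prefix_nonneg_def)
  moreover have "0 \<le> sum_list (map h (take (length l - k) (rotate k l)))"
    using assms(3,4) \<open>k \<noteq> 0\<close> unfolding prefix_nonneg_def by simp
  then have "0 \<le> sum_list (map h (drop k l))"
    by (simp add: rot)
  moreover have "sum_list (map h (take k l)) + sum_list (map h (drop k l)) = -1"
    using assms(1) by (metis append_take_drop_id map_append sum_list_append)
  ultimately show False by linarith
qed

text \<open>The good rotation starts where the partial sums first reach their minimum: from there on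
  no partial sum lies lower. Two good rotations are rotations of each other, which the preceding
  lemma excludes unless they have the same index.\<close>

lemma ex1_rotation_prefix_nonneg:
  assumes sum: "sum_list (map h l) = -1"
  shows "\<exists>!k. k < length l \<and> prefix_nonneg h (rotate k l)"
proof -
  define S where "S = (\<lambda>k. sum_list (map h (take k l)))"
  define m where "m = length l"
  have "l \<noteq> []" using sum by auto
  then have m0: "m > 0" by (simp add: m_def)
  have S0: "S 0 = 0" and Sm: "S m = -1"
    using sum by (simp_all add: S_def m_def)
  define \<mu> where "\<mu> = Min (S ` {..m})"
  have \<mu>_le: "\<mu> \<le> S k" if "k \<le> m" for k
    unfolding \<mu>_def using that by (intro Min_le) auto
  have "\<mu> \<in> S ` {..m}"
    unfolding \<mu>_def by (intro Min_in) auto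
  then have ex: "\<exists>k. k \<le> m \<and> S k = \<mu>" by auto
  \<comment> \<open>Choosing the first minimum gives strict inequality before \<open>k\<close>; this
    extra unit compensates the total \<open>-1\<close> for prefixes that wrap around the
    end.\<close>
  define k where "k = (LEAST k. k \<le> m \<and> S k = \<mu>)"
  have k: "k \<le> m" "S k = \<mu>"
    using LeastI_ex[OF ex] by (simp_all add: k_def)
  have first: "\<mu> < S j" if "j < k" for j
  proof -
    have "\<not> (j \<le> m \<and> S j = \<mu>)"
      using that unfolding k_def by (rule not_less_Least)
    then show ?thesis using \<mu>_le[of j] that k by force
  qed
  have "\<mu> \<le> -1" using \<mu>_le[of m] Sm by simp
  have good: "prefix_nonneg h (drop k l @ take k l)"
    unfolding prefix_nonneg_def
  proof (intro allI impI)
    fix j assume "j < length (drop k l @ take k l)"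
    then have j: "j < m" using k by (simp add: m_def)
    show "0 \<le> sum_list (map h (take j (drop k l @ take k l)))"
    proof (cases "j \<le> m - k")
      case True
      then have "k + j \<le> m" using k by simp
      have "S (k + j) = S k + sum_list (map h (take j (drop k l)))"
        by (simp add: S_def take_add)
      moreover have "take j (drop k l @ take k l) = take j (drop k l)"
        using True by (simp add: m_def)
      ultimately show ?thesis using \<mu>_le[OF \<open>k + j \<le> m\<close>] k by (metis add_le_same_cancel1 le_add_same_cancel1)
    next
      case False
      define i where "i = j - (m - k)"
      have i: "i < k" using False j k by (simp add: i_def)
      have "take j (drop k l @ take k l) = drop k l @ take i l"
        using False i by (simp add: m_def i_def min_def)
      moreover have "S k + sum_list (map h (drop k l)) = -1"
        using sum unfolding S_def by (metis append_take_drop_id map_append sum_list_append)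
      ultimately have "sum_list (map h (take j (drop k l @ take k l))) = -1 - S k + S i"
        by (simp add: S_def)
      then show ?thesis using first[OF i] k by simp
    qed
  qed
  \<comment> \<open>The minimum may first be reached at \<open>k = m\<close>, where the rotation is
    the identity; reduction modulo \<open>m\<close> brings the index into the required
    range.\<close>
  have "rotate (k mod m) l = drop k l @ take k l"
    using k m0 by (cases "k = m") (simp_all add: rotate_drop_take m_def)
  with good have "k mod m < m \<and> prefix_nonneg h (rotate (k mod m) l)"
    using m0 by simp
  moreover have "i = j" if "i \<le> j" "j < m" "prefix_nonneg h (rotate i l)" "prefix_nonneg h (rotate j l)" for i j
  proof -
    have "sum_list (map h (rotate i l)) = -1"
      using sum unfolding rotate_drop_take
      by (metis add.commute append_take_drop_id map_append sum_list_append)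
    moreover have "rotate (j - i) (rotate i l) = rotate j l"
      using that by (simp add: rotate_rotate)
    ultimately have "j - i = 0"
      using that by (intro prefix_nonneg_unique_rotation[of h "rotate i l"]) (auto simp: m_def)
    then show ?thesis using that by simp
  qed
  ultimately show ?thesis
    unfolding m_def[symmetric] by (metis nat_le_linear)
qed

text \<open>Double counting of the pairs of a list in \<open>L\<close> and an index
  \<open>k < m\<close> whose rotation is good. Each list has exactly one such \<open>k\<close>. For
  fixed \<open>k\<close>, rotation is an injective self-map of the finite set \<open>L\<close>,
  hence a weight-preserving permutation, so every \<open>k\<close> contributes the sum over the good
  lists.\<close>

lemma cycle_lemma:
  fixes wt :: "'a list \<Rightarrow> 'b::comm_semiring_1"
  assumes fin: "finite L"
    and len: "\<And>l. l \<in> L \<Longrightarrow> length l = m"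
    and sum: "\<And>l. l \<in> L \<Longrightarrow> sum_list (map h l) = -1"
    and rot: "\<And>l. l \<in> L \<Longrightarrow> rotate1 l \<in> L"
    and wt: "\<And>l. l \<in> L \<Longrightarrow> wt (rotate1 l) = wt l"
  shows "(\<Sum>l\<in>L. wt l) = of_nat m * (\<Sum>l\<in>{l\<in>L. prefix_nonneg h l}. wt l)"
proof -
  have rot': "rotate k l \<in> L \<and> wt (rotate k l) = wt l" if "l \<in> L" for k l
    using that by (induction k) (simp_all add: rot wt)
  have bij: "bij_betw (rotate k) L L" for k
  proof -
    have "inj (rotate k :: 'a list \<Rightarrow> _)"
      unfolding rotate_def by (intro inj_fn inj_rotate1)
    then have "inj_on (rotate k) L" by (rule inj_on_subset) simp
    moreover have "rotate k ` L \<subseteq> L" using rot' by auto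
    ultimately show ?thesis
      using fin by (simp add: bij_betw_def endo_inj_surj)
  qed
  have "(\<Sum>l\<in>L. wt l) = (\<Sum>l\<in>L. \<Sum>k<m. if prefix_nonneg h (rotate k l) then wt l else 0)"
  proof (intro sum.cong refl)
    fix l assume l: "l \<in> L"
    obtain k where k: "k < m" "prefix_nonneg h (rotate k l)"
      and uniq: "\<And>j. j < m \<Longrightarrow> prefix_nonneg h (rotate j l) \<Longrightarrow> j = k"
      using ex1_rotation_prefix_nonneg[OF sum[OF l]] len[OF l] by metis
    have "prefix_nonneg h (rotate j l) \<longleftrightarrow> j = k" if "j < m" for j
      using k(2) uniq[OF that] by blast
    then have "(\<Sum>j<m. if prefix_nonneg h (rotate j l) then wt l else 0) = (\<Sum>j<m. if j = k then wt l else 0)"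
      by (intro sum.cong refl if_cong) auto
    then show "wt l = (\<Sum>j<m. if prefix_nonneg h (rotate j l) then wt l else 0)"
      using k by simp
  qed
  also have "\<dots> = (\<Sum>k<m. \<Sum>l\<in>L. if prefix_nonneg h (rotate k l) then wt l else 0)"
    by (rule sum.swap)
  also have "\<dots> = (\<Sum>k<m. \<Sum>l\<in>L. if prefix_nonneg h l then wt l else 0)"
  proof (rule sum.cong[OF refl])
    fix k
    have "(\<Sum>l\<in>L. if prefix_nonneg h (rotate k l) then wt l else 0)
        = (\<Sum>l\<in>L. if prefix_nonneg h (rotate k l) then wt (rotate k l) else 0)"
      using rot' by (intro sum.cong refl) auto
    also have "\<dots> = (\<Sum>l\<in>L. if prefix_nonneg h l then wt l else 0)"
      by (rule sum.reindex_bij_betw[OF bij])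
    finally show "(\<Sum>l\<in>L. if prefix_nonneg h (rotate k l) then wt l else 0) = \<dots>" .
  qed
  also have "\<dots> = of_nat m * (\<Sum>l\<in>{l\<in>L. prefix_nonneg h l}. wt l)"
    using fin by (simp add: sum.inter_filter)
  finally show ?thesis .
qed

section \<open>Encoding of step lists by pieces, and the weight of an encoded list\<close>

fun expand :: "'a \<Rightarrow> (nat \<times> 'a) list \<Rightarrow> 'a list" where
  "expand u [] = []"
| "expand u ((b, x) # l) = replicate b u @ x # expand u l"

lemma expand_append: "expand u (l @ l') = expand u l @ expand u l'"
  by (induction u l rule: expand.induct) auto

lemma set_expand_subset: "set (expand u l) \<subseteq> insert u (snd ` set l)"
  by (induction u l rule: expand.induct) auto

lemma expand_eq_Nil_iff [simp]: "expand u l = [] \<longleftrightarrow> l = []"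
  by (cases "(u, l)" rule: expand.cases) auto

text \<open>The first letter other than \<open>u\<close> marks the end of the initial run, so the
  first piece can be read off from the list.\<close>

lemma replicate_append_Cons_eq_iff:
  assumes "x \<noteq> u" "y \<noteq> u"
  shows "replicate b u @ x # xs = replicate c u @ y # ys \<longleftrightarrow> b = c \<and> x = y \<and> xs = ys"
  using assms
proof (induction b arbitrary: c)
  case 0 then show ?case by (cases c) auto
next
  case (Suc b) then show ?case by (cases c) auto
qed

text \<open>Decoding proceeds piece by piece. It relies on closing letters differing from
  \<open>u\<close>: otherwise \<open>[(1, x)]\<close> and \<open>[(0, u), (0, x)]\<close> would have
  the same expansion.\<close>

lemma expand_inject:
  "u \<notin> snd ` set l \<Longrightarrow> u \<notin> snd ` set l' \<Longrightarrow> expand u l = expand u l' \<Longrightarrow> l = l'"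
proof (induction u l arbitrary: l' rule: expand.induct)
  case (1 u)
  then show ?case by (metis expand_eq_Nil_iff)
next
  case (2 u b x l)
  then obtain c y k where l': "l' = (c, y) # k"
    by (cases l') auto
  have "x \<noteq> u" "y \<noteq> u" using "2.prems"(1,2) l' by auto
  then have "b = c" "x = y" "expand u l = expand u k"
    using "2.prems"(3) by (simp_all add: l' replicate_append_Cons_eq_iff)
  moreover from this have "l = k"
    using "2.prems"(1,2) by (intro "2.IH") (simp_all add: l')
  ultimately show ?case by (simp add: l')
qed

text \<open>The appended \<open>x\<close> closes a possible final run of \<open>u\<close>. Reading
  from the front, a letter of \<open>S\<close> becomes a piece with empty block, and any other
  letter lengthens the block of the piece that follows, which exists because of
  \<open>x\<close>.\<close>

lemma expand_surj:
  "set P \<subseteq> insert u S \<Longrightarrow> x \<in> S \<Longrightarrow> \<exists>l. expand u l = P @ [x] \<and> snd ` set l \<subseteq> S"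
proof (induction P)
  case Nil
  then show ?case by (intro exI[of _ "[(0, x)]"]) auto
next
  case (Cons y P)
  then obtain l where l: "expand u l = P @ [x]" "snd ` set l \<subseteq> S" by auto
  show ?case
  proof (cases "y \<in> S")
    case True
    with l show ?thesis by (intro exI[of _ "(0, y) # l"]) auto
  next
    case False
    then have "y = u" using Cons by auto
    obtain b z k where "l = (b, z) # k"
      using l by (cases l) auto
    with l \<open>y = u\<close> show ?thesis by (intro exI[of _ "(Suc b, z) # k"]) auto
  qed
qed

text \<open>A letter outside \<open>A\<close> ends every running block, so no block meets both sides
  of it.\<close>

lemma block_lengths_append_Cons_notin:
  "x \<notin> A \<Longrightarrow> block_lengths A (xs @ x # ys) = block_lengths A xs @ block_lengths A ys"
proof (induction A xs rule: block_lengths.induct)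
  case (2 A y xs)
  show ?case
  \<comment> \<open>Either the run starting at \<open>y\<close> may extend up to the separating
    letter \<open>x\<close>, or it already stops inside \<open>xs\<close>.\<close>
  proof (cases "\<forall>z\<in>set xs. z \<in> A")
    case True
    then have "takeWhile (\<lambda>y. y \<in> A) (xs @ x # ys) = xs" "dropWhile (\<lambda>y. y \<in> A) (xs @ x # ys) = x # ys"
      "takeWhile (\<lambda>y. y \<in> A) xs = xs" "dropWhile (\<lambda>y. y \<in> A) xs = []"
      using 2(3) by (auto simp: takeWhile_append dropWhile_append)
    note tw = this
    have "block_lengths A (xs @ x # ys) = block_lengths A xs @ block_lengths A ys" if "y \<notin> A"
      using 2 that by simp
    with tw 2(3) show ?thesis
      by (cases "y \<in> A") (simp_all only: block_lengths.simps append_Cons append_Nil if_True if_False simp_thms)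
  next
    case False
    then have "takeWhile (\<lambda>y. y \<in> A) (xs @ x # ys) = takeWhile (\<lambda>y. y \<in> A) xs"
      "dropWhile (\<lambda>y. y \<in> A) (xs @ x # ys) = dropWhile (\<lambda>y. y \<in> A) xs @ x # ys"
      by (auto simp: takeWhile_append dropWhile_append)
    then show ?thesis using 2 by simp
  qed
qed auto

lemma block_lengths_replicate:
  "u \<in> A \<Longrightarrow> block_lengths A (replicate b u) = (if b = 0 then [] else [b])"
  by (cases b) (auto simp: takeWhile_replicate dropWhile_replicate)

text \<open>Empty blocks are absent from \<open>block_lengths\<close> but present among the pieces;
  they contribute the constant term \<open>1\<close> of \<open>F_series f\<close>, so the product
  may run over all pieces.\<close>

lemma prod_list_block_lengths_expand:
  assumes "u \<notin> snd ` set l"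
  shows "prod_list (map f (block_lengths {u} (expand u l))) =
    prod_list (map (fps_nth (F_series f)) (map fst l))"
  using assms
  by (induction u l rule: expand.induct)
    (auto simp: block_lengths_append_Cons_notin block_lengths_replicate F_series_def)

text \<open>\<open>natpermute n m\<close> consists of the lists of \<open>m\<close> naturals with
  sum \<open>n\<close>. The product is taken along the list so that it can be matched with the block
  lengths of \<open>m\<close> pieces.\<close>

lemma fps_nth_power_natpermute:
  fixes a :: "'a::comm_ring_1 fps"
  shows "fps_nth (a ^ m) n = (\<Sum>v\<in>natpermute n m. prod_list (map (fps_nth a) v))"
proof (cases m)
  case 0
  then show ?thesis by (simp add: natpermute_0)
next
  case (Suc k)
  show ?thesis
    unfolding Suc fps_power_nth_Suc
    by (intro sum.cong) (auto simp: natpermute_def prod.list_conv_set_nth atLeastLessThanSuc_atLeastAtMost)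
qed


section \<open>Lattice paths as good lists of pieces\<close>

definition rise :: "int \<times> int \<Rightarrow> nat \<times> int \<times> int \<Rightarrow> int" where
  "rise u p = int (fst p) * snd u + snd (snd p)"

text \<open>Serves for the closing steps of \<open>m\<close> pieces, with \<open>t\<close> the
  displacement that the \<open>U\<close>-steps leave for them.\<close>

definition step_lists :: "(int \<times> int) set \<Rightarrow> nat \<Rightarrow> int \<times> int \<Rightarrow> (int \<times> int) list set" where
  "step_lists S m t = {xs. set xs \<subseteq> S \<and> length xs = m \<and> sum_list xs = t}"

lemma sum_list_replicate_pair:
  fixes u :: "int \<times> int"
  shows "sum_list (replicate b u) = (int b * fst u, int b * snd u)"
  by (induction b) (auto simp: algebra_simps plus_prod_def zero_prod_def)

lemma sum_list_expand:
  fixes u :: "int \<times> int"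
  shows "sum_list (expand u l) =
    (int (sum_list (map fst l)) * fst u, int (sum_list (map fst l)) * snd u) + sum_list (map snd l)"
  by (induction u l rule: expand.induct)
    (auto simp: algebra_simps plus_prod_def zero_prod_def sum_list_replicate_pair)

lemma snd_sum_list_expand: "snd (sum_list (expand u l)) = sum_list (map (rise u) l)"
  by (induction u l rule: expand.induct)
    (auto simp: algebra_simps rise_def sum_list_replicate_pair)

lemma append_eq_replicateD:
  assumes "xs @ ys = replicate b u"
  shows "xs = replicate (length xs) u"
proof (rule replicate_eqI)
  fix y assume "y \<in> set xs"
  then have "y \<in> set (replicate b u)" using assms[symmetric] by simp
  then show "y = u" by simp
qed simp

text \<open>Inside a block the path does not descend, so its height is at least that at the end of
  the preceding piece. The trailing \<open>replicate b u\<close> is an unclosed block: removing the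
  closing step of the last piece leaves a list of the same shape, which drives the
  induction.\<close>

lemma expand_prefix_nonneg:
  assumes u: "snd u \<ge> 0"
    and "\<And>k. k \<le> length l \<Longrightarrow> 0 \<le> sum_list (map (rise u) (take k l))"
    and "A @ B = expand u l @ replicate b u"
  shows "0 \<le> snd (sum_list A)"
  using assms(2,3)
proof (induction l arbitrary: A B b rule: rev_induct)
  case Nil
  then have "A = replicate (length A) u"
    by (auto intro: append_eq_replicateD)
  then have "snd (sum_list A) = int (length A) * snd u"
    by (metis sum_list_replicate_pair snd_conv)
  then show ?case using u by simp
next
  case (snoc p l)
  obtain c y where p: "p = (c, y)" by (cases p) auto
  have nonneg: "0 \<le> sum_list (map (rise u) (take k l))" if "k \<le> length l" for k
    using snoc.prems(1)[of k] that by simp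
  from snoc.prems(2) have "A @ B = (expand u l @ replicate c u) @ y # replicate b u"
    by (simp add: p expand_append)
  \<comment> \<open>Either \<open>A\<close> stops before the closing step \<open>y\<close> of the
    last piece, or it contains \<open>y\<close> and ends in the trailing block.\<close>
  then consider C where "A @ C = expand u l @ replicate c u"
    | C where "A = expand u l @ replicate c u @ y # C" "C @ B = replicate b u"
    by (auto simp: append_eq_append_conv2 append_eq_Cons_conv Cons_eq_append_conv)
  then show ?case
  proof cases
    case 1
    then show ?thesis using snoc.IH nonneg by blast
  next
    case 2
    then have "C = replicate (length C) u"
      by (intro append_eq_replicateD)
    with 2 have "A = expand u (l @ [p]) @ replicate (length C) u"
      by (simp add: p expand_append)
    then have "snd (sum_list A) = sum_list (map (rise u) (l @ [p])) + int (length C) * snd u"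
      by (metis sum_list_append snd_add snd_sum_list_expand sum_list_replicate_pair snd_conv)
    moreover have "0 \<le> sum_list (map (rise u) (l @ [p]))"
      using snoc.prems(1)[of "length (l @ [p])"] by simp
    ultimately show ?thesis using u by simp
  qed
qed

text \<open>Appending \<open>d\<close> to a path closes its last block and brings the height from
  \<open>0\<close> to \<open>-1\<close>; \<open>butlast\<close> undoes this. Nonnegativity at the
  ends of the proper initial pieces suffices because blocks never descend.\<close>

lemma bij_betw_expand_lattice_paths:
  assumes u: "snd u \<ge> 0" "u \<notin> S"
    and d: "d \<in> S" "snd d = -1"
    and up: "\<And>x. x \<in> S \<Longrightarrow> x \<noteq> d \<Longrightarrow> snd x \<ge> 0"
  shows "bij_betw (\<lambda>l. butlast (expand u l))
    {l. snd ` set l \<subseteq> S \<and> sum_list (expand u l) = (int n + fst d, -1) \<and> prefix_nonneg (rise u) l}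
    (lattice_paths (insert u S) n)" (is "bij_betw _ ?G _")
proof -
  have G: "expand u l = butlast (expand u l) @ [d] \<and> butlast (expand u l) \<in> lattice_paths (insert u S) n"
    if "l \<in> ?G" for l
  proof -
    from that have l: "snd ` set l \<subseteq> S" "sum_list (expand u l) = (int n + fst d, -1)"
      "prefix_nonneg (rise u) l" by auto
    have neg: "sum_list (map (rise u) l) = -1"
      using l(2) by (metis snd_conv snd_sum_list_expand)
    then have "l \<noteq> []" by auto
    then obtain l' b x where l': "l = l' @ [(b, x)]"
      by (metis append_butlast_last_id surj_pair)
    have nonneg: "0 \<le> sum_list (map (rise u) (take k l'))" if "k \<le> length l'" for k
      using l(3) that unfolding prefix_nonneg_def l' by (auto dest: spec[of _ k])
    \<comment> \<open>The last piece leads from a nonnegative height to \<open>-1\<close>, so it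
      must descend, and only \<open>d\<close> descends.\<close>
    have "x = d"
    proof (rule ccontr)
      assume "x \<noteq> d"
      then have "0 \<le> rise u (b, x)" using up[of x] u l(1) by (auto simp: rise_def l')
      then show False using neg nonneg[of "length l'"] by (simp add: l')
    qed
    then have *: "expand u l = (expand u l' @ replicate b u) @ [d]"
      by (simp add: l' expand_append)
    define P where "P = expand u l' @ replicate b u"
    have P: "expand u l = P @ [d]" using * by (simp add: P_def)
    have "set P \<subseteq> insert u S"
      using set_expand_subset[of u l] l(1) unfolding P by (fastforce simp del: insert_subset)
    moreover have "sum_list P = (int n, 0)"
      using l(2) d unfolding P by (auto simp: prod_eq_iff)
    \<comment> \<open>\<open>P\<close> is made of the pieces before the last one and the last block
      without its closing step.\<close>
    moreover have "0 \<le> snd (sum_list (take k P))" for k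
      by (rule expand_prefix_nonneg[OF u(1) nonneg, where A = "take k P" and B = "drop k P" and b = b])
        (simp_all add: P_def del: take_append drop_append)
    ultimately show ?thesis
      unfolding P by (simp add: lattice_paths_def)
  qed
  have "inj_on (\<lambda>l. butlast (expand u l)) ?G"
  proof (rule inj_onI)
    fix l l' assume l: "l \<in> ?G" "l' \<in> ?G" "butlast (expand u l) = butlast (expand u l')"
    have "expand u l = expand u l'" using G[OF l(1)] G[OF l(2)] l(3) by argo
    moreover have "u \<notin> snd ` set l" "u \<notin> snd ` set l'" using l(1,2) u(2) by auto
    ultimately show "l = l'" by (metis expand_inject)
  qed
  moreover have "P \<in> (\<lambda>l. butlast (expand u l)) ` ?G" if "P \<in> lattice_paths (insert u S) n" for P
  proof -
    from that have P: "set P \<subseteq> insert u S" "sum_list P = (int n, 0)"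
      "\<And>k. k \<le> length P \<Longrightarrow> 0 \<le> snd (sum_list (take k P))"
      by (auto simp: lattice_paths_def)
    obtain l where l: "expand u l = P @ [d]" "snd ` set l \<subseteq> S"
      using expand_surj[OF P(1) d(1)] by blast
    have "prefix_nonneg (rise u) l"
      unfolding prefix_nonneg_def
    proof (intro allI impI)
      fix k assume k: "k < length l"
      \<comment> \<open>The remaining pieces have a nonempty expansion, which contains the final
        \<open>d\<close>; hence the first \<open>k\<close> pieces expand to a prefix of
        \<open>P\<close> itself.\<close>
      have eq: "expand u (take k l) @ expand u (drop k l) = P @ [d]"
        using l(1) by (simp flip: expand_append)
      moreover have "expand u (drop k l) \<noteq> []" using k by simp
      ultimately have "expand u (take k l) = take (length (expand u (take k l))) P"
        "length (expand u (take k l)) \<le> length P"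
        by (auto simp: append_eq_append_conv2 append_eq_Cons_conv)
      then have "0 \<le> snd (sum_list (expand u (take k l)))" using P(3) by metis
      then show "0 \<le> sum_list (map (rise u) (take k l))"
        by (simp add: snd_sum_list_expand)
    qed
    moreover have "sum_list (expand u l) = (int n + fst d, -1)"
      using P(2) d l(1) by (simp add: prod_eq_iff)
    ultimately show ?thesis using l by (intro image_eqI[of _ _ l]) auto
  qed
  ultimately show ?thesis
    using G by (auto simp: bij_betw_def)
qed

section \<open>Summation over lists of pieces\<close>

lemma bij_betw_pieces:
  "bij_betw (\<lambda>l. (map fst l, map snd l))
    {l. snd ` set l \<subseteq> S \<and> length l = m \<and> sum_list (map fst l) = i \<and> sum_list (map snd l) = t}
    (natpermute i m \<times> step_lists S m t)"
  by (rule bij_betw_byWitness[where f' = "\<lambda>(v, xs). zip v xs"])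
    (auto simp: zip_map_fst_snd natpermute_def step_lists_def dest: set_zip_rightD)

text \<open>The weight depends on the block lengths alone, so every admissible list of closing steps
  contributes the same factor, a coefficient of \<open>F ^ m\<close>.\<close>

lemma sum_pieces:
  fixes f :: "nat \<Rightarrow> complex"
  shows "(\<Sum>l | snd ` set l \<subseteq> S \<and> length l = m \<and> sum_list (map fst l) = i \<and> sum_list (map snd l) = t.
      prod_list (map (fps_nth F) (map fst l)))
    = fps_nth (F ^ m) i * (of_nat (card (step_lists S m t)) :: complex)" (is "sum ?g ?L = _")
proof -
  have "sum ?g ?L = (\<Sum>(v, xs)\<in>natpermute i m \<times> step_lists S m t. prod_list (map (fps_nth F) v))"
    by (subst sum.reindex_bij_betw[OF bij_betw_pieces, symmetric]) simp
  also have "\<dots> = (\<Sum>v\<in>natpermute i m. \<Sum>xs\<in>step_lists S m t. prod_list (map (fps_nth F) v))"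
    by (rule sum.cartesian_product[symmetric])
  also have "\<dots> = fps_nth (F ^ m) i * of_nat (card (step_lists S m t))"
    by (simp add: fps_nth_power_natpermute sum_distrib_left mult.commute)
  finally show ?thesis .
qed

lemma sum_prod_list_map_rotate1:
  fixes g :: "'a \<Rightarrow> 'b::comm_monoid_add" and h :: "'a \<Rightarrow> 'c::comm_monoid_mult"
  shows "sum_list (map g (rotate1 l)) = sum_list (map g l)"
    and "prod_list (map h (rotate1 l)) = prod_list (map h l)"
  by (cases l; simp add: ac_simps)+

text \<open>Good lists are grouped by their number \<open>m\<close> of pieces and number
  \<open>i\<close> of \<open>U\<close>-steps, and the cycle lemma is applied to each group.
  \<open>B\<close> is a finite set containing all pairs that occur; \<open>t i\<close> is the
  displacement left for the closing steps, the appended \<open>d\<close> included. Finiteness is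
  assumed group by group because \<open>V\<close> may be infinite.\<close>

lemma weighted_count_eq_sum:
  assumes u: "snd u \<ge> 0" "u \<notin> V"
    and d: "snd d = -1"
    and up: "\<And>x. x \<in> V \<Longrightarrow> snd x \<ge> 0"
    and B: "finite B"
    and supp: "\<And>m i. m > 0 \<Longrightarrow> step_lists (insert d V) m (t i) \<noteq> {} \<Longrightarrow> (m, i) \<in> B"
    and fin: "\<And>m i. (m, i) \<in> B \<Longrightarrow> m > 0 \<and> finite (step_lists (insert d V) m (t i))"
    and t: "\<And>i. t i = (int n + fst d - int i * fst u, -1 - int i * snd u)"
  shows "weighted_count {u} V {d} f n =
    (\<Sum>(m, i)\<in>B. 1 / of_nat m * fps_nth (F_series f ^ m) i * of_nat (card (step_lists (insert d V) m (t i))))"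
proof -
  define S where "S = insert d V"
  define G where "G = {l. snd ` set l \<subseteq> S \<and> sum_list (expand u l) = (int n + fst d, -1) \<and> prefix_nonneg (rise u) l}"
  define L where "L = (\<lambda>(m, i). {l. snd ` set l \<subseteq> S \<and> length l = m \<and> sum_list (map fst l) = i \<and> sum_list (map snd l) = t i})"
  define wt where "wt = (\<lambda>l :: (nat \<times> int \<times> int) list. prod_list (map (fps_nth (F_series f)) (map fst l)))"
  have uS: "u \<notin> S" using u d by (auto simp: S_def)
  have total: "sum_list (expand u l) = (int n + fst d, -1) \<longleftrightarrow> sum_list (map snd l) = t (sum_list (map fst l))" for l
    by (auto simp: sum_list_expand t prod_eq_iff)
  have rises: "sum_list (map (rise u) l) = -1" if "l \<in> L p" for l p
  proof -
    have "sum_list (expand u l) = (int n + fst d, -1)"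
      using that by (auto simp: total L_def)
    then show ?thesis by (metis snd_conv snd_sum_list_expand)
  qed
  have bij: "bij_betw (\<lambda>l. butlast (expand u l)) G (lattice_paths (insert u S) n)"
    unfolding G_def using u uS d up
    by (intro bij_betw_expand_lattice_paths) (auto simp: S_def)
  have G_eq: "G = (\<Union>p\<in>B. {l \<in> L p. prefix_nonneg (rise u) l})"
  proof (intro equalityI subsetI)
    fix l assume l: "l \<in> G"
    define m i where "m = length l" and "i = sum_list (map fst l)"
    have lL: "l \<in> L (m, i)" using l by (auto simp: G_def L_def m_def i_def total)
    then have "map snd l \<in> step_lists S m (t i)" by (auto simp: L_def step_lists_def)
    moreover have "m > 0" using rises[OF lL] by (auto simp: m_def)
    ultimately have "(m, i) \<in> B" using supp unfolding S_def by blast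
    with lL l show "l \<in> (\<Union>p\<in>B. {l \<in> L p. prefix_nonneg (rise u) l})"
      by (auto simp: G_def)
  qed (auto simp: G_def L_def total)
  have finL: "finite (L p)" if "p \<in> B" for p
  proof -
    obtain m i where p: "p = (m, i)" by fastforce
    have "finite (natpermute i m \<times> step_lists S m (t i))"
      using fin that by (auto simp: p S_def natpermute_finite)
    then show ?thesis
      using bij_betw_finite[OF bij_betw_pieces] by (auto simp: p L_def)
  qed
  have "weighted_count {u} V {d} f n
      = (\<Sum>P\<in>lattice_paths (insert u S) n. prod_list (map f (block_lengths {u} P)))"
    by (simp add: weighted_count_def S_def insert_commute)
  also have "\<dots> = (\<Sum>l\<in>G. prod_list (map f (block_lengths {u} (butlast (expand u l)))))"
    by (rule sum.reindex_bij_betw[OF bij, symmetric])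
  also have "\<dots> = (\<Sum>l\<in>G. wt l)"
  proof (intro sum.cong refl)
    fix l assume l: "l \<in> G"
    then obtain p where "l \<in> L p" using G_eq by auto
    from rises[OF this] have "l \<noteq> []" by auto
    have "last (expand u l) \<in> S" using \<open>l \<noteq> []\<close> l
      by (cases l rule: rev_cases) (auto simp: G_def expand_append)
    then have "last (expand u l) \<notin> {u}" using uS by auto
    \<comment> \<open>The removed final step is not \<open>u\<close>, so it belongs to no
      block.\<close>
    from block_lengths_append_Cons_notin[OF this, of "butlast (expand u l)" "[]"]
    have "block_lengths {u} (butlast (expand u l)) = block_lengths {u} (expand u l)"
      using \<open>l \<noteq> []\<close> by simp
    moreover have "u \<notin> snd ` set l" using l uS by (auto simp: G_def)
    ultimately show "prod_list (map f (block_lengths {u} (butlast (expand u l)))) = wt l"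
      by (simp add: prod_list_block_lengths_expand wt_def)
  qed
  also have "\<dots> = (\<Sum>p\<in>B. \<Sum>l | l \<in> L p \<and> prefix_nonneg (rise u) l. wt l)"
    unfolding G_eq using B finL by (intro sum.UNION_disjoint) (auto simp: L_def)
  also have "\<dots> = (\<Sum>(m, i)\<in>B. 1 / of_nat m * fps_nth (F_series f ^ m) i * of_nat (card (step_lists S m (t i))))"
  proof (intro sum.cong refl, clarify)
    fix m i assume p: "(m, i) \<in> B"
    have "(\<Sum>l\<in>L (m, i). wt l) = of_nat m * (\<Sum>l | l \<in> L (m, i) \<and> prefix_nonneg (rise u) l. wt l)"
    proof (rule cycle_lemma)
      show "finite (L (m, i))" by (rule finL[OF p])
      show "sum_list (map (rise u) l) = -1" if "l \<in> L (m, i)" for l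
        by (rule rises[OF that])
    qed (auto simp: L_def wt_def sum_prod_list_map_rotate1)
    moreover have "(\<Sum>l\<in>L (m, i). wt l) = fps_nth (F_series f ^ m) i * of_nat (card (step_lists S m (t i)))"
      unfolding L_def wt_def prod.case by (rule sum_pieces)
    moreover have "(of_nat m :: complex) \<noteq> 0" using fin[OF p] by simp
    ultimately show "(\<Sum>l | l \<in> L (m, i) \<and> prefix_nonneg (rise u) l. wt l)
      = 1 / of_nat m * fps_nth (F_series f ^ m) i * of_nat (card (step_lists S m (t i)))"
      by (simp add: field_simps)
  qed
  finally show ?thesis unfolding S_def .
qed

text \<open>The common form for both formulas: \<open>T\<close> parametrizes the occurring pairs
  injectively, and \<open>c\<close> is a closed form for the number of lists of closing
  steps.\<close>

lemma weighted_count_eq_sum_reindex: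
  assumes u: "snd u \<ge> 0" "u \<notin> V"
    and d: "snd d = -1"
    and up: "\<And>x. x \<in> V \<Longrightarrow> snd x \<ge> 0"
    and T: "finite T"
    and inj: "inj_on (\<lambda>z. (m z, i z)) T"
    and t: "\<And>k. t k = (int n + fst d - int k * fst u, -1 - int k * snd u)"
    and supp: "\<And>k xs. xs \<in> step_lists (insert d V) (length xs) (t k) \<Longrightarrow> \<exists>z\<in>T. length xs = m z \<and> k = i z"
    and cnt: "\<And>z. z \<in> T \<Longrightarrow> finite (step_lists (insert d V) (m z) (t (i z))) \<and>
      of_nat (card (step_lists (insert d V) (m z) (t (i z)))) = c z"
    and pos: "\<And>z. z \<in> T \<Longrightarrow> m z > 0"
  shows "weighted_count {u} V {d} f n =
    (\<Sum>z\<in>T. 1 / of_nat (m z) * fps_nth (F_series f ^ m z) (i z) * c z)"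
proof -
  have "weighted_count {u} V {d} f n =
    (\<Sum>(m, k)\<in>(\<lambda>z. (m z, i z)) ` T. 1 / of_nat m * fps_nth (F_series f ^ m) k * of_nat (card (step_lists (insert d V) m (t k))))"
  proof (rule weighted_count_eq_sum[OF u d up])
    fix l k assume "step_lists (insert d V) l (t k) \<noteq> {}"
    then obtain xs where "xs \<in> step_lists (insert d V) l (t k)" by auto
    moreover from this have "length xs = l" by (simp add: step_lists_def)
    ultimately show "(l, k) \<in> (\<lambda>z. (m z, i z)) ` T" using supp[of xs k] by auto
  qed (use T t cnt pos in auto)
  also have "\<dots> = (\<Sum>z\<in>T. 1 / of_nat (m z) * fps_nth (F_series f ^ m z) (i z) * c z)"
    using inj cnt by (simp add: sum.reindex)
  finally show ?thesis .
qed

section \<open>Counting lists of closing steps\<close>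

lemma V_series_fps_X:
  assumes "inj_on s J"
  shows "V_series J r s 1 fps_X = Abs_fps (\<lambda>k. if k \<in> s ` J then 1 else 0)"
  unfolding V_series_def
proof (rule infsumI, rule has_sum_fpsI)
  fix k
  \<comment> \<open>The summand of \<open>x\<close> has its only nonzero coefficient,
    \<open>1\<close>, at exponent \<open>s x\<close>; by injectivity at most one index contributes
    to each \<open>k\<close>.\<close>
  have eq: "{x \<in> J. fps_nth (1 ^ r x * fps_X ^ s x :: complex fps) k \<noteq> 0} = {x \<in> J. s x = k}"
    by auto
  consider "{x \<in> J. s x = k} = {}" "k \<notin> s ` J" | x where "{x \<in> J. s x = k} = {x}" "k \<in> s ` J" "s x = k"
  proof (cases "k \<in> s ` J")
    case True
    then obtain x where "x \<in> J" "s x = k" by auto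
    then show ?thesis using assms that(2)[of x] by (auto simp: inj_on_def)
  qed (use that in auto)
  note cases = this
  show "finite {x \<in> J. fps_nth (1 ^ r x * fps_X ^ s x :: complex fps) k \<noteq> 0}"
    by (cases rule: cases) (simp_all only: eq finite.intros)
  show "fps_nth (Abs_fps (\<lambda>k. if k \<in> s ` J then 1 else 0)) k =
    (\<Sum>x | x \<in> J \<and> fps_nth (1 ^ r x * fps_X ^ s x :: complex fps) k \<noteq> 0. fps_nth (1 ^ r x * fps_X ^ s x) k)"
    unfolding eq
  proof (cases rule: cases)
    case 1
    show "fps_nth (Abs_fps (\<lambda>k. if k \<in> s ` J then 1 else 0)) k = (\<Sum>x | x \<in> J \<and> s x = k. fps_nth (1 ^ r x * fps_X ^ s x) k)"
      unfolding 1(1) using 1(2) by simp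
  qed simp
qed

lemma prod_list_indicator:
  "prod_list (map (\<lambda>k. if k \<in> H then 1 else 0) v) = (if set v \<subseteq> H then 1 else 0 :: 'a::comm_semiring_1)"
  by (induction v) auto

text \<open>Raising every step by one turns the down step into \<open>0\<close> and the height
  \<open>k\<close> into \<open>Suc k\<close>. The lists become lists of \<open>m\<close> naturals
  from \<open>H'\<close> with sum \<open>q\<close>, counted by the \<open>m\<close>-th power of the
  indicator series of \<open>H'\<close>.\<close>

lemma step_lists_unit_width:
  shows "finite (step_lists (insert (1, -1) {(1, int k) | k. k \<in> H}) m (int m, int q - int m))"
    and "of_nat (card (step_lists (insert (1, -1) {(1, int k) | k. k \<in> H}) m (int m, int q - int m))) =
      fps_nth ((1 + fps_X * Abs_fps (\<lambda>k. if k \<in> H then 1 else 0 :: 'a::comm_ring_1)) ^ m) q" (is "_ = fps_nth (?a ^ m) q")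
proof -
  define g :: "nat \<Rightarrow> int \<times> int" where "g = (\<lambda>k. (1, int k - 1))"
  define H' where "H' = insert 0 (Suc ` H)"
  let ?S = "insert (1, -1) {(1, int k) | k. k \<in> H}"
  let ?N = "{v \<in> natpermute q m. set v \<subseteq> H'}"
  have S: "?S = g ` H'" by (auto simp: g_def H'_def image_image)
  have sum_g: "sum_list (map g v) = (int (length v), int (sum_list v) - int (length v))" for v
    by (induction v) (auto simp: g_def zero_prod_def)
  have "inj g" by (auto simp: inj_def g_def)
  then have inj: "inj_on (map g) ?N"
    by (meson inj_mapI inj_on_subset subset_UNIV)
  have eq: "map g ` ?N = step_lists ?S m (int m, int q - int m)"
  proof (intro equalityI subsetI)
    fix xs assume xs: "xs \<in> step_lists ?S m (int m, int q - int m)"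
    then have "xs \<in> lists (g ` H')" by (auto simp: step_lists_def S)
    then obtain v where v: "xs = map g v" "set v \<subseteq> H'" by (auto simp: lists_image)
    with xs show "xs \<in> map g ` ?N"
      by (auto simp: step_lists_def sum_g natpermute_def)
  next
    fix xs assume "xs \<in> map g ` ?N"
    then obtain v where v: "xs = map g v" "v \<in> ?N" by blast
    then have "set xs \<subseteq> g ` H'" by auto
    with v show "xs \<in> step_lists ?S m (int m, int q - int m)"
      unfolding S by (simp add: step_lists_def sum_g natpermute_def)
  qed
  have fin: "finite ?N" by (simp add: natpermute_finite)
  then show "finite (step_lists ?S m (int m, int q - int m))" by (simp flip: eq)
  have "fps_nth ?a = (\<lambda>k. if k \<in> H' then 1 else 0 :: 'a)"
    by (rule ext, rename_tac k, case_tac k) (auto simp: H'_def)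
  then have "fps_nth (?a ^ m) q = (\<Sum>v\<in>natpermute q m. if set v \<subseteq> H' then 1 else 0)"
    by (simp add: fps_nth_power_natpermute prod_list_indicator)
  also have "\<dots> = of_nat (card ?N)"
    by (simp add: natpermute_finite flip: sum.inter_filter)
  also have "card ?N = card (step_lists ?S m (int m, int q - int m))"
    by (simp add: card_image[OF inj] flip: eq)
  finally show "of_nat (card (step_lists ?S m (int m, int q - int m))) = fps_nth (?a ^ m) q" ..
qed

text \<open>Splitting by the first letter gives the recurrence of Pascal's triangle.\<close>

lemma card_lists_two_letters:
  assumes "p \<noteq> d"
  shows "card {xs. set xs \<subseteq> {p, d} \<and> length xs = m \<and> count_list xs p = j} = m choose j"
proof (induction m arbitrary: j)
  case 0
  have "{xs. set xs \<subseteq> {p, d} \<and> length xs = 0 \<and> count_list xs p = j} = (if j = 0 then {[]} else {})"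
    by auto
  then show ?case by (cases j) auto
next
  case (Suc m)
  let ?A = "\<lambda>m j. {xs. set xs \<subseteq> {p, d} \<and> length xs = m \<and> count_list xs p = j}"
  have fin: "finite (?A m j)" for j
    by (rule finite_subset[OF _ finite_lists_length_eq[of "{p, d}" m]]) auto
  have *: "?A (Suc m) j = Cons d ` ?A m j \<union> (if j = 0 then {} else Cons p ` ?A m (j - 1))"
    using assms by (auto simp: length_Suc_conv split: if_splits)
  show ?case
  proof (cases j)
    case 0
    then show ?thesis unfolding * using Suc.IH by (simp add: card_image)
  next
    case (Suc i)
    have "card (?A (Suc m) j) = card (Cons d ` ?A m j) + card (Cons p ` ?A m i)"
      unfolding * using Suc fin assms by (simp, subst card_Un_disjoint) auto
    then show ?thesis using Suc.IH Suc by (simp add: card_image)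
  qed
qed

lemma sum_list_two_letters:
  assumes "set xs \<subseteq> {p, d}" "p \<noteq> d"
  shows "sum_list (map g xs) = of_nat (count_list xs p) * g p + of_nat (length xs - count_list xs p) * (g d :: 'a::comm_semiring_1)"
  using assms(1)
proof (induction xs)
  case (Cons x xs)
  then show ?case
    using count_le_length[of xs p] assms(2) by (auto simp: algebra_simps Suc_diff_le)
qed simp

lemma sum_list_fst: "fst (sum_list xs) = sum_list (map fst xs)"
  and sum_list_snd: "snd (sum_list xs) = sum_list (map snd xs)"
  by (induction xs) auto

section \<open>The two explicit formulas\<close>

theorem theorem2p3:
  fixes I J K :: "'i set" and r s :: "'i \<Rightarrow> nat" and f :: "nat \<Rightarrow> complex"
    and U V W :: "(int \<times> int) set"
  assumes "countable I" "countable J" "countable K"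
    and "I \<inter> J = {}" "I \<inter> K = {}" "J \<inter> K = {}"
    and "\<forall>i\<in>I \<union> J \<union> K. r i > 0"
    and "U = {(int (r i), int (s i)) | i. i \<in> I}"
    and "V = {(int (r i), int (s i)) | i. i \<in> J}"
    and "W = {(int (r i), -1) | i. i \<in> K}"
    and "U \<inter> V = {}"
  shows
    "(\<forall>a::nat. U = {(1, int a)} \<and> (\<forall>i\<in>J. r i = 1) \<and> inj_on (\<lambda>i. (r i, s i)) J \<and> W = {(1, -1)} \<longrightarrow>
        (\<forall>n. weighted_count U V W f n =
          (\<Sum>i = 0..n div (a + 1).
             1 / of_nat (n - i + 1)
             * fps_nth (F_series f ^ (n - i + 1)) i
             * fps_nth ((1 + fps_X * V_series J r s 1 fps_X) ^ (n - i + 1)) (n - (a + 1) * i))))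
     \<and>
     (\<forall>r1 r2 w s1 s2 :: nat. r1 > 0 \<and> r2 > 0 \<and> w > 0 \<and>
        U = {(int r1, int s1)} \<and> V = {(int r2, int s2)} \<and> W = {(int w, -1)} \<longrightarrow>
        (\<forall>n. weighted_count U V W f n =
          (\<Sum>(i, j) \<in> {(i, j). (w * s1 + r1) * i + (w * s2 + r2) * j = n}.
             1 / of_nat (s1 * i + (s2 + 1) * j + 1)
             * fps_nth (F_series f ^ (s1 * i + (s2 + 1) * j + 1)) i
             * of_nat ((s1 * i + (s2 + 1) * j + 1) choose j))))"
proof (intro conjI allI impI; elim conjE)
  fix a n :: nat
  assume U: "U = {(1, int a)}" and r: "\<forall>i\<in>J. r i = 1" and inj: "inj_on (\<lambda>i. (r i, s i)) J"
    and W: "W = {(1, -1)}"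
  have V: "V = {(1, int k) | k. k \<in> s ` J}"
    using assms(9) r by force
  \<comment> \<open>All widths are \<open>1\<close>, so distinct steps have distinct heights and
    \<open>V(1,x)\<close> is the indicator series of the set of heights.\<close>
  have "inj_on s J"
    using inj r by (auto simp: inj_on_def)
  note ser = V_series_fps_X[OF this, of r]
  show "weighted_count U V W f n =
          (\<Sum>i = 0..n div (a + 1).
             1 / of_nat (n - i + 1)
             * fps_nth (F_series f ^ (n - i + 1)) i
             * fps_nth ((1 + fps_X * V_series J r s 1 fps_X) ^ (n - i + 1)) (n - (a + 1) * i))"
    unfolding U W ser
  proof (rule weighted_count_eq_sum_reindex[where t = "\<lambda>k. (int n + 1 - int k, -1 - int k * int a)"])
    show "(1, int a) \<notin> V" using assms(11) U by auto
    show "snd x \<ge> 0" if "x \<in> V" for x using that V by auto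
    show "inj_on (\<lambda>i. (n - i + 1, i)) {0..n div (a + 1)}" by (auto simp: inj_on_def)
    show "\<exists>z\<in>{0..n div (a + 1)}. length xs = n - z + 1 \<and> k = z"
      if xs: "xs \<in> step_lists (insert (1, -1) V) (length xs) (int n + 1 - int k, -1 - int k * int a)" for k xs
    proof -
      \<comment> \<open>Unit widths force the number of closing steps to be
        \<open>n + 1 - k\<close>. Each descends by at most one, whence
        \<open>(a + 1) * k \<le> n\<close>.\<close>
      have "set xs \<subseteq> insert (1, -1) V" using xs by (simp add: step_lists_def)
      then have "fst (sum_list xs) = int (length xs) \<and> snd (sum_list xs) \<ge> - int (length xs)"
        by (induction xs) (auto simp: V)
      then have "int n + 1 - int k = int (length xs)" "-1 - int k * int a \<ge> - int (length xs)"
        using xs by (auto simp: step_lists_def)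
      then have len: "int (length xs) = int n + 1 - int k" and "int ((a + 1) * k) \<le> int n"
        by (auto simp: algebra_simps)
      then have "k * (a + 1) \<le> n" by (simp only: of_nat_le_iff mult.commute)
      then have k: "k \<le> n div (a + 1)" by (simp add: less_eq_div_iff_mult_less_eq)
      then have "k \<le> n" using div_le_dividend order_trans by blast
      with k len show ?thesis by auto
    qed
    fix i assume "i \<in> {0..n div (a + 1)}"
    then have i: "(a + 1) * i \<le> n"
      by (simp add: less_eq_div_iff_mult_less_eq mult.commute)
    then have "i \<le> n" by (simp add: algebra_simps)
    \<comment> \<open>Raising each of the \<open>n - i + 1\<close> closing steps by one turns their
      total height \<open>-1 - i * a\<close> into \<open>q\<close>.\<close>
    define q where "q = n - (a + 1) * i"
    have "int q = int n - int ((a + 1) * i)" unfolding q_def using i by (rule of_nat_diff)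
    then have eq: "(int n + 1 - int i, -1 - int i * int a) = (int (n - i + 1), int q - int (n - i + 1))"
      using \<open>i \<le> n\<close> by (simp add: algebra_simps)
    show "finite (step_lists (insert (1, -1) V) (n - i + 1) (int n + 1 - int i, -1 - int i * int a)) \<and>
      of_nat (card (step_lists (insert (1, -1) V) (n - i + 1) (int n + 1 - int i, -1 - int i * int a))) =
      fps_nth ((1 + fps_X * Abs_fps (\<lambda>k. if k \<in> s ` J then 1 else 0 :: complex)) ^ (n - i + 1)) (n - (a + 1) * i)"
      unfolding eq V q_def[symmetric] by (rule conjI[OF step_lists_unit_width(1)]) (rule step_lists_unit_width(2))
  qed auto
next
  fix r1 r2 w s1 s2 n :: nat
  assume pos: "r1 > 0" "r2 > 0" "w > 0"
    and U: "U = {(int r1, int s1)}" and V: "V = {(int r2, int s2)}" and W: "W = {(int w, -1)}"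
  define T where "T = {(i, j). (w * s1 + r1) * i + (w * s2 + r2) * j = n}"
  \<comment> \<open>For \<open>i\<close> steps in \<open>U\<close> and \<open>j\<close> in
    \<open>V\<close>, return to height \<open>-1\<close> requires \<open>s1 * i + s2 * j + 1\<close>
    down steps, the appended one included; adding the \<open>j\<close> steps in \<open>V\<close>
    gives the number of pieces.\<close>
  define m where "m = (\<lambda>(i, j). s1 * i + (s2 + 1) * j + 1)"
  define p d where "p = (int r2, int s2)" and "d = (int w, -1 :: int)"
  define t where "t = (\<lambda>k. (int n + int w - int k * int r1, -1 - int k * int s1))"
  have pd: "p \<noteq> d" by (simp add: p_def d_def)
  \<comment> \<open>The vertical equation determines the number \<open>l\<close> of down steps.
    Substituted into the horizontal one, it leaves the equation defining \<open>T\<close>, since the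
    width \<open>w\<close> of the appended step cancels.\<close>
  have key: "sum_list xs = t i \<longleftrightarrow> (i, count_list xs p) \<in> T \<and> length xs = m (i, count_list xs p)"
    if xs: "set xs \<subseteq> {d, p}" for xs i
  proof -
    define j where "j = count_list xs p"
    define l where "l = length xs - j"
    have len: "length xs = l + j" using count_le_length[of xs p] by (simp add: l_def j_def)
    have "set xs \<subseteq> {p, d}" using xs by auto
    from sum_list_two_letters[OF this pd, of fst] sum_list_two_letters[OF this pd, of snd]
    have "sum_list xs = (int j * int r2 + int l * int w, int j * int s2 - int l)"
      by (simp add: prod_eq_iff sum_list_fst sum_list_snd p_def d_def l_def j_def)
    then have "sum_list xs = t i \<longleftrightarrow>
        int j * int r2 + int l * int w + int i * int r1 = int n + int w \<and> int l = int j * int s2 + int i * int s1 + 1"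
      by (auto simp: t_def)
    also have "\<dots> \<longleftrightarrow> j * r2 + l * w + i * r1 = n + w \<and> l = j * s2 + i * s1 + 1"
      by (metis (no_types, lifting) of_nat_1 of_nat_add of_nat_eq_iff of_nat_mult)
    also have "\<dots> \<longleftrightarrow> (i, j) \<in> T \<and> l + j = m (i, j)"
      by (auto simp: T_def m_def algebra_simps)
    finally show ?thesis by (simp add: len j_def[symmetric])
  qed
  have "weighted_count U V W f n =
      (\<Sum>z\<in>T. 1 / of_nat (m z) * fps_nth (F_series f ^ m z) (fst z) * of_nat (m z choose snd z))"
    unfolding U W
  proof (rule weighted_count_eq_sum_reindex[where t = t])
    show "(int r1, int s1) \<notin> V" using assms(11) U by auto
    have "i \<le> n \<and> j \<le> n" if "(w * s1 + r1) * i + (w * s2 + r2) * j = n" for i j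
    proof -
      have "1 * i \<le> (w * s1 + r1) * i" "1 * j \<le> (w * s2 + r2) * j"
        using pos by (intro mult_right_mono; simp)+
      then show ?thesis using that by linarith
    qed
    then have "T \<subseteq> {..n} \<times> {..n}" by (auto simp: T_def)
    then show "finite T" by (rule finite_subset) simp
    show "inj_on (\<lambda>z. (m z, fst z)) T"
    proof (rule inj_onI, clarify)
      fix i j i' j' assume "m (i, j) = m (i', j')" "fst (i, j) = fst (i', j')"
      then have "(s2 + 1) * j = (s2 + 1) * j'" by (simp add: m_def)
      then show "i = i' \<and> j = j'" using \<open>fst (i, j) = fst (i', j')\<close> by (simp only: mult_cancel1) simp
    qed
    show "\<exists>z\<in>T. length xs = m z \<and> k = fst z"
      if "xs \<in> step_lists (insert (int w, -1) V) (length xs) (t k)" for k xs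
      using that key[of xs k] by (force simp: step_lists_def V p_def d_def)
    fix z assume "z \<in> T"
    obtain i j where z: "z = (i, j)" by fastforce
    \<comment> \<open>For given \<open>i\<close>, the number of pieces determines \<open>j\<close>,
      because \<open>s2 + 1\<close> is nonzero; so the lists to be counted have exactly
      \<open>j\<close> letters \<open>p\<close>.\<close>
    have uniq: "j' = j" if "m (i, j') = m (i, j)" for j'
    proof -
      have "(s2 + 1) * j' = (s2 + 1) * j" using that by (simp add: m_def)
      then show ?thesis by (simp only: mult_cancel1) simp
    qed
    have "step_lists {d, p} (m z) (t i) = {xs. set xs \<subseteq> {p, d} \<and> length xs = m z \<and> count_list xs p = j}"
      using key \<open>z \<in> T\<close> uniq unfolding z step_lists_def by (auto simp: insert_commute)
    moreover have "finite {xs. set xs \<subseteq> {p, d} \<and> length xs = m z \<and> count_list xs p = j}"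
      by (rule finite_subset[OF _ finite_lists_length_eq[of "{p, d}" "m z"]]) auto
    ultimately show "finite (step_lists (insert (int w, -1) V) (m z) (t (fst z))) \<and>
      of_nat (card (step_lists (insert (int w, -1) V) (m z) (t (fst z)))) = of_nat (m z choose snd z)"
      using card_lists_two_letters[OF pd, of "m z" j] by (simp add: z V p_def d_def)
  qed (auto simp: V t_def m_def)
  then show "weighted_count U V W f n =
          (\<Sum>(i, j) \<in> {(i, j). (w * s1 + r1) * i + (w * s2 + r2) * j = n}.
             1 / of_nat (s1 * i + (s2 + 1) * j + 1)
             * fps_nth (F_series f ^ (s1 * i + (s2 + 1) * j + 1)) i
             * of_nat ((s1 * i + (s2 + 1) * j + 1) choose j))"
    by (simp add: T_def m_def case_prod_unfold)
qed

end
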